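(* For a positive integer $n$, define two elements of $\mathcal{A}_{\mathbb{Z}[t]}$ by $$f_n(t):=\sum_{k=0}^{n-2}\left(\sum_{i=1}^{n-k-1}\zeta^{(i)}_{\mathcal{A}}(\{1\}^{n-k-2}, 2)\,t^{i\boldsymbol{p}}\right)\pounds^{\mathrm{OY}}_{\mathcal{A}, \{1\}^k}(t)$$ and $$g_n(t):=\sum_{k=0}^{n-2}\left(\sum_{i=1}^{n-k-2}\zeta^{(i)}_{\mathcal{A}}(\{1\}^{n-k-2})\,t^{i\boldsymbol{p}}\right)\pounds^{\mathrm{OY}}_{\mathcal{A}, (2, \{1\}^k)}(t),$$ where empty sums are understood to be $0$. Then for every positive integer $n$, in $\mathcal{A}_{\mathbb{Z}[t]}$, $$\pounds^{\mathrm{OY}}_{\mathcal{A}, \{1\}^n}(t)=\frac{1}{n!}\pounds^{\mathrm{OY}}_{\mathcal{A}, 1}(t)^n+\frac{1}{n!}\sum_{k=1}^n(k-1)!\,\bigl(f_k(t)+g_k(t)\bigr)\,\pounds^{\mathrm{OY}}_{\mathcal{A}, 1}(t)^{n-k}.$$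
   Context: Let $\mathcal{A}_{\mathbb{Z}[t]}:=\bigl(\prod_p (\mathbb{Z}/p\mathbb{Z})[t]\bigr)/\bigl(\bigoplus_p (\mathbb{Z}/p\mathbb{Z})[t]\bigr)$ and $\mathcal{A}:=\bigl(\prod_p \mathbb{Z}/p\mathbb{Z}\bigr)/\bigl(\bigoplus_p \mathbb{Z}/p\mathbb{Z}\bigr)$, where $p$ runs over all primes. These are $\mathbb{Q}$-algebras, and $\mathcal{A}\subset\mathcal{A}_{\mathbb{Z}[t]}$ via constant polynomials. An element is represented by a family $(f_p)_p$; two families represent the same element if and only if $f_p=g_p$ for all but finitely many primes $p$. For $i\ge 1$, $t^{i\boldsymbol{p}}$ denotes the class of $(t^{ip} \bmod p)_p$. For $r\ge1$ and an index $\mathbf{k}=(k_1,\ldots,k_r)\in(\mathbb{Z}_{\ge1})^r$, the finite multiple polylogarithm of Ono--Yamamoto type is the element of $\mathcal{A}_{\mathbb{Z}[t]}$ whose $p$-component is $$\pounds^{\mathrm{OY}}_{\mathcal{A},\mathbf{k}}(t):=\sum'_{0<l_1,\ldots,l_r<p}\frac{t^{l_1+\cdots+l_r}}{l_1^{k_1}(l_1+l_2)^{k_2}\cdots(l_1+\cdots+l_r)^{k_r}} \bmod p,$$ where $\sum'$ means that the sum is only over the terms whose denominators are prime to $p$. For the empty index, $\pounds^{\mathrm{OY}}_{\mathcal{A},\emptyset}(t):=1$. For an index $\mathbf{k}=(k_1,\ldots,k_r)$ and $1\le i\le r$, define the element of $\mathcal{A}$ $$\zeta^{(i)}_{\mathcal{A}}(\mathbf{k}):=\sum'_{\substack{0<l_1,\ldots,l_r<p\\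 (i-1)p<l_1+\cdots+l_r<ip}}\frac{1}{l_1^{k_1}(l_1+l_2)^{k_2}\cdots(l_1+\cdots+l_r)^{k_r}} \bmod p,$$ with the same meaning of $\sum'$. $\{1\}^n$ denotes $1,\ldots,1$ ($n$ times), so that $\{1\}^0$ is empty, $(\{1\}^m,2)=(1,\ldots,1,2)$ and $(2,\{1\}^k)=(2,1,\ldots,1)$; $\pounds^{\mathrm{OY}}_{\mathcal{A},1}(t)$ is the case of the index $(1)$. *)

theory Defs
  imports
    "HOL-Computational_Algebra.Computational_Algebra"
    "HOL-Number_Theory.Modular_Inverse"
begin

definition almost_all_primes :: "(nat \<Rightarrow> bool) \<Rightarrow> bool" where
  "almost_all_primes P \<longleftrightarrow> finite {p. prime p \<and> \<not> P p}"

lemma almost_all_primesI: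
  assumes "\<And>p. prime p \<Longrightarrow> P p"
  shows "almost_all_primes P"
proof -
  have "{p. prime p \<and> \<not> P p} = {}"
    using assms by blast
  then show ?thesis
    unfolding almost_all_primes_def by (simp only: finite.emptyI)
qed

lemma almost_all_primes_mono:
  assumes "almost_all_primes P" "\<And>p. prime p \<Longrightarrow> P p \<Longrightarrow> Q p"
  shows "almost_all_primes Q"
  using assms unfolding almost_all_primes_def
  by (elim finite_subset[rotated]) auto

lemma almost_all_primes_mono2:
  assumes "almost_all_primes P" "almost_all_primes Q"
    "\<And>p. prime p \<Longrightarrow> P p \<Longrightarrow> Q p \<Longrightarrow> R p"
  shows "almost_all_primes R"
proof -
  have "finite ({p. prime p \<and> \<not> P p} \<union> {p. prime p \<and> \<not> Q p})"
    using assms(1,2) by (simp add: almost_all_primes_def)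
  then show ?thesis
    unfolding almost_all_primes_def by (rule finite_subset[rotated]) (use assms(3) in blast)
qed

lemma almost_all_primes_False: "\<not> almost_all_primes (\<lambda>p. False)"
  using primes_infinite by (simp add: almost_all_primes_def)

lemma almost_all_primes_not_dvd:
  assumes "d \<noteq> (0::int)"
  shows "almost_all_primes (\<lambda>p. \<not> int p dvd d)"
proof -
  have "{p. prime p \<and> \<not> \<not> int p dvd d} \<subseteq> {..nat \<bar>d\<bar>}"
    using assms by (auto dest: dvd_imp_le_int)
  then show ?thesis
    unfolding almost_all_primes_def using finite_subset by blast
qed

text \<open>
  An element of \<open>\<Prod>\<^sub>p \<int>/p\<int>\<close> is represented by a family of integers, its \<open>p\<close>-th entry standing
  for its class mod \<open>p\<close>; an element of \<open>\<Prod>\<^sub>p (\<int>/p\<int>)[t]\<close> is represented by a family of integer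
  polynomials, its \<open>p\<close>-th entry standing for its class in \<open>(\<int>/p\<int>)[t] = \<int>[t]/p\<int>[t]\<close>. Families are
  functions on all natural numbers, but the entries at non-primes are ignored. The quotients
  below identify at once congruent representatives and families that agree at almost all primes.
\<close>

definition eqv_A :: "(nat \<Rightarrow> int) \<Rightarrow> (nat \<Rightarrow> int) \<Rightarrow> bool" where
  "eqv_A f g \<longleftrightarrow> almost_all_primes (\<lambda>p. [f p = g p] (mod int p))"

definition eqv_AZt :: "(nat \<Rightarrow> int poly) \<Rightarrow> (nat \<Rightarrow> int poly) \<Rightarrow> bool" where
  "eqv_AZt f g \<longleftrightarrow> almost_all_primes (\<lambda>p. \<forall>n. [coeff (f p) n = coeff (g p) n] (mod int p))"

lemma eqv_A_dvd: "eqv_A f g \<longleftrightarrow> almost_all_primes (\<lambda>p. int p dvd f p - g p)"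
  by (simp add: eqv_A_def cong_iff_dvd_diff)

lemma eqv_AZt_dvd: "eqv_AZt f g \<longleftrightarrow> almost_all_primes (\<lambda>p. [:int p:] dvd f p - g p)"
  by (simp add: eqv_AZt_def cong_iff_dvd_diff const_poly_dvd_iff)

lemma eqv_A_refl: "eqv_A f f"
  by (auto simp: eqv_A_def intro: almost_all_primesI)

lemma eqv_AZt_refl: "eqv_AZt f f"
  by (auto simp: eqv_AZt_def intro: almost_all_primesI)

quotient_type A = "nat \<Rightarrow> int" / eqv_A
proof (rule equivpI)
  show "reflp eqv_A"
    by (rule reflpI) (rule eqv_A_refl)
  show "symp eqv_A"
    by (rule sympI) (auto simp: eqv_A_def cong_sym_eq)
  show "transp eqv_A"
    by (rule transpI, unfold eqv_A_def, erule (1) almost_all_primes_mono2) (rule cong_trans)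
qed

quotient_type AZt = "nat \<Rightarrow> int poly" / eqv_AZt
proof (rule equivpI)
  show "reflp eqv_AZt"
    by (rule reflpI) (rule eqv_AZt_refl)
  show "symp eqv_AZt"
    by (rule sympI) (auto simp: eqv_AZt_def cong_sym_eq)
  show "transp eqv_AZt"
    by (rule transpI, unfold eqv_AZt_def, erule (1) almost_all_primes_mono2) (blast intro: cong_trans)
qed

lemma mult_diff_split:
  "a * b - c * d = a * (b - d) + (a - c) * (d :: 'a :: comm_ring)"
  by (simp add: algebra_simps)

instantiation A :: comm_ring_1
begin

lift_definition zero_A :: A is "\<lambda>p. 0" .

lift_definition one_A :: A is "\<lambda>p. 1" .

lift_definition plus_A :: "A \<Rightarrow> A \<Rightarrow> A" is "\<lambda>f g p. f p + g p"
  unfolding eqv_A_def by (erule (1) almost_all_primes_mono2) (rule cong_add)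

lift_definition minus_A :: "A \<Rightarrow> A \<Rightarrow> A" is "\<lambda>f g p. f p - g p"
  unfolding eqv_A_def by (erule (1) almost_all_primes_mono2) (rule cong_diff)

lift_definition uminus_A :: "A \<Rightarrow> A" is "\<lambda>f p. - f p"
  by (auto simp: eqv_A_def cong_minus_minus_iff)

lift_definition times_A :: "A \<Rightarrow> A \<Rightarrow> A" is "\<lambda>f g p. f p * g p"
  unfolding eqv_A_def by (erule (1) almost_all_primes_mono2) (rule cong_mult)

instance
proof
  fix a b c :: A
  show "a * b * c = a * (b * c)"
    by transfer (simp add: mult.assoc eqv_A_refl)
  show "a * b = b * a"
    by transfer (simp add: mult.commute eqv_A_refl)
  show "1 * a = a"
    by transfer (simp add: eqv_A_refl)
  show "a + b + c = a + (b + c)"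
    by transfer (simp add: add.assoc eqv_A_refl)
  show "a + b = b + a"
    by transfer (simp add: add.commute eqv_A_refl)
  show "0 + a = a"
    by transfer (simp add: eqv_A_refl)
  show "- a + a = 0"
    by transfer (simp add: eqv_A_refl)
  show "a - b = a + - b"
    by transfer (simp add: eqv_A_refl)
  show "(a + b) * c = a * c + b * c"
    by transfer (simp add: distrib_right eqv_A_refl)
  show "(0 :: A) \<noteq> 1"
  proof (transfer, rule notI)
    assume "eqv_A (\<lambda>p. 0) (\<lambda>p. 1)"
    then have "almost_all_primes (\<lambda>p. False)"
      unfolding eqv_A_dvd by (rule almost_all_primes_mono) auto
    then show False
      using almost_all_primes_False by blast
  qed
qed

end

instantiation AZt :: comm_ring_1
begin

lift_definition zero_AZt :: AZt is "\<lambda>p. 0" .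

lift_definition one_AZt :: AZt is "\<lambda>p. 1" .

lift_definition plus_AZt :: "AZt \<Rightarrow> AZt \<Rightarrow> AZt" is "\<lambda>f g p. f p + g p"
  unfolding eqv_AZt_def by (erule (1) almost_all_primes_mono2) (simp add: cong_add)

lift_definition minus_AZt :: "AZt \<Rightarrow> AZt \<Rightarrow> AZt" is "\<lambda>f g p. f p - g p"
  unfolding eqv_AZt_def by (erule (1) almost_all_primes_mono2) (simp add: cong_diff)

lift_definition uminus_AZt :: "AZt \<Rightarrow> AZt" is "\<lambda>f p. - f p"
  by (auto simp: eqv_AZt_def cong_minus_minus_iff)

lift_definition times_AZt :: "AZt \<Rightarrow> AZt \<Rightarrow> AZt" is "\<lambda>f g p. f p * g p"
  unfolding eqv_AZt_dvd
  by (erule (1) almost_all_primes_mono2, subst mult_diff_split) (intro dvd_add dvd_mult dvd_mult2)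

instance
proof
  fix a b c :: AZt
  show "a * b * c = a * (b * c)"
    by transfer (simp add: mult.assoc eqv_AZt_refl)
  show "a * b = b * a"
    by transfer (simp add: mult.commute eqv_AZt_refl)
  show "1 * a = a"
    by transfer (simp add: eqv_AZt_refl)
  show "a + b + c = a + (b + c)"
    by transfer (simp add: add.assoc eqv_AZt_refl)
  show "a + b = b + a"
    by transfer (simp add: add.commute eqv_AZt_refl)
  show "0 + a = a"
    by transfer (simp add: eqv_AZt_refl)
  show "- a + a = 0"
    by transfer (simp add: eqv_AZt_refl)
  show "a - b = a + - b"
    by transfer (simp add: eqv_AZt_refl)
  show "(a + b) * c = a * c + b * c"
    by transfer (simp add: distrib_right eqv_AZt_refl)
  show "(0 :: AZt) \<noteq> 1"
  proof (transfer, rule notI)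
    assume "eqv_AZt (\<lambda>p. 0) (\<lambda>p. 1)"
    then have "almost_all_primes (\<lambda>p. False)"
      unfolding eqv_AZt_def
      by (rule almost_all_primes_mono) (auto simp: cong_iff_dvd_diff dest: spec[of _ 0])
    then show False
      using almost_all_primes_False by blast
  qed
qed

end

lift_definition A_to_AZt :: "A \<Rightarrow> AZt" is "\<lambda>f p. [:f p:]"
  unfolding eqv_A_dvd eqv_AZt_dvd
  by (erule almost_all_primes_mono) simp

lemma A_to_AZt_hom:
  "A_to_AZt 1 = 1"
  "A_to_AZt (x + y) = A_to_AZt x + A_to_AZt y"
  "A_to_AZt (x * y) = A_to_AZt x * A_to_AZt y"
proof -
  show "A_to_AZt 1 = 1"
    by transfer (simp add: eqv_AZt_refl flip: one_pCons)
  show "A_to_AZt (x + y) = A_to_AZt x + A_to_AZt y"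
    by transfer (simp add: eqv_AZt_refl)
  show "A_to_AZt (x * y) = A_to_AZt x * A_to_AZt y"
    by transfer (simp add: eqv_AZt_refl mult.commute)
qed

lemma inj_A_to_AZt: "inj A_to_AZt"
proof -
  have "A_to_AZt x = A_to_AZt y \<Longrightarrow> x = y" for x y
    by (transfer, unfold eqv_A_dvd eqv_AZt_dvd, erule almost_all_primes_mono)
       simp
  then show ?thesis
    by (rule injI)
qed

text \<open>
  The structure map of the \<open>\<rat>\<close>-algebra \<open>A\<close>: a rational number is reduced mod \<open>p\<close> at all primes
  not dividing its denominator. At the finitely many others the library's \<open>modular_inverse\<close> is
  \<open>0\<close>, which does not matter.
\<close>

lift_definition rat_to_A :: "rat \<Rightarrow> A" is
  "\<lambda>q p. case quotient_of q of (a, b) \<Rightarrow> a * modular_inverse (int p) b" .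

lemma rat_red_cong:
  assumes "quotient_of q = (a, b)" "prime p" "\<not> int p dvd b"
  shows "[(case quotient_of q of (a, b) \<Rightarrow> a * modular_inverse (int p) b) * b = a] (mod int p)"
proof -
  have "coprime b (int p)"
    using assms(2,3) prime_imp_coprime[of "int p" b] by (simp add: coprime_commute)
  then have "[a * (modular_inverse (int p) b * b) = a * 1] (mod int p)"
    by (intro cong_mult cong_refl cong_modular_inverse2)
  then show ?thesis
    using assms(1) by (simp add: mult_ac)
qed

lemma rat_to_A_hom:
  "rat_to_A 1 = 1"
  "rat_to_A (q + r) = rat_to_A q + rat_to_A r"
  "rat_to_A (q * r) = rat_to_A q * rat_to_A r"
proof -
  let ?\<rho> = "\<lambda>q p. case quotient_of q of (a, b) \<Rightarrow> a * modular_inverse (int p) b"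
  show "rat_to_A 1 = 1"
  proof transfer
    show "eqv_A (?\<rho> 1) (\<lambda>p. 1)"
      unfolding eqv_A_def
      by (rule almost_all_primesI) (auto dest: prime_gt_1_nat)
  qed
  obtain a b where ab: "quotient_of q = (a, b)" by (cases "quotient_of q")
  obtain c d where cd: "quotient_of r = (c, d)" by (cases "quotient_of r")
  have pos: "b > 0" "d > 0"
    using ab cd quotient_of_denom_pos by blast+
  have q: "q = of_int a / of_int b" and r: "r = of_int c / of_int d"
    using ab cd quotient_of_div by blast+
  {
    fix s e f z and w :: "nat \<Rightarrow> int"
    assume ef: "quotient_of s = (e, f)" and s: "s = of_int z / (of_int b * of_int d)"
      and w: "\<And>p. \<lbrakk>[?\<rho> q p * b = a] (mod int p); [?\<rho> r p * d = c] (mod int p)\<rbrakk>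
              \<Longrightarrow> [w p * (b * d) = z] (mod int p)"
    have f: "f > 0"
      using ef quotient_of_denom_pos by blast
    have "rat_of_int e / of_int f = of_int z / (of_int b * of_int d)"
      using quotient_of_div[OF ef] s by simp
    then have "rat_of_int (e * (b * d)) = of_int (z * f)"
      using pos f by (simp add: field_simps)
    then have cross: "e * (b * d) = z * f"
      by (simp only: of_int_eq_iff)
    have "almost_all_primes (\<lambda>p. \<not> int p dvd b * d * f)"
      using pos f by (intro almost_all_primes_not_dvd) auto
    then have "eqv_A (?\<rho> s) w"
      unfolding eqv_A_def
    proof (rule almost_all_primes_mono)
      fix p :: nat
      assume p: "prime p" and nd: "\<not> int p dvd b * d * f"
      have nds: "\<not> int p dvd b" "\<not> int p dvd d" "\<not> int p dvd f"
        using nd by auto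
      have "[?\<rho> s p * f * (b * d) = e * (b * d)] (mod int p)"
        by (intro cong_mult cong_refl rat_red_cong[OF ef p nds(3)])
      moreover have "[w p * (b * d) * f = z * f] (mod int p)"
        by (intro cong_mult cong_refl w rat_red_cong[OF ab p nds(1)] rat_red_cong[OF cd p nds(2)])
      ultimately have "[?\<rho> s p * (b * d * f) = w p * (b * d * f)] (mod int p)"
        unfolding cross by (simp add: mult_ac cong_def)
      moreover have "coprime (b * d * f) (int p)"
        using p nd prime_imp_coprime[of "int p" "b * d * f"] by (simp add: coprime_commute)
      ultimately show "[?\<rho> s p = w p] (mod int p)"
        using cong_mult_rcancel by blast
    qed
  } note main = this
  have "eqv_A (?\<rho> (q + r)) (\<lambda>p. ?\<rho> q p + ?\<rho> r p)"
  proof (cases "quotient_of (q + r)")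
    case (Pair e f)
    show ?thesis
    proof (rule main[OF Pair, of "a * d + c * b"])
      show "q + r = of_int (a * d + c * b) / (of_int b * of_int d)"
        using pos by (simp add: q r field_simps)
    next
      fix p
      assume "[?\<rho> q p * b = a] (mod int p)" "[?\<rho> r p * d = c] (mod int p)"
      then have "[?\<rho> q p * b * d + ?\<rho> r p * d * b = a * d + c * b] (mod int p)"
        by (intro cong_add cong_mult cong_refl)
      then show "[(?\<rho> q p + ?\<rho> r p) * (b * d) = a * d + c * b] (mod int p)"
        by (simp add: algebra_simps)
    qed
  qed
  then show "rat_to_A (q + r) = rat_to_A q + rat_to_A r"
    by transfer
  have "eqv_A (?\<rho> (q * r)) (\<lambda>p. ?\<rho> q p * ?\<rho> r p)"
  proof (cases "quotient_of (q * r)")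
    case (Pair e f)
    show ?thesis
    proof (rule main[OF Pair, of "a * c"])
      show "q * r = of_int (a * c) / (of_int b * of_int d)"
        by (simp add: q r)
    next
      fix p
      assume "[?\<rho> q p * b = a] (mod int p)" "[?\<rho> r p * d = c] (mod int p)"
      then have "[(?\<rho> q p * b) * (?\<rho> r p * d) = a * c] (mod int p)"
        by (intro cong_mult)
      then show "[?\<rho> q p * ?\<rho> r p * (b * d) = a * c] (mod int p)"
        by (simp add: mult_ac)
    qed
  qed
  then show "rat_to_A (q * r) = rat_to_A q * rat_to_A r"
    by transfer
qed

definition scaleQ :: "rat \<Rightarrow> AZt \<Rightarrow> AZt" where
  "scaleQ q x = A_to_AZt (rat_to_A q) * x"

lemma module_scaleQ: "module scaleQ"
  by unfold_locales (simp_all add: scaleQ_def rat_to_A_hom A_to_AZt_hom algebra_simps)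

lift_definition t_pow_p :: "nat \<Rightarrow> AZt" is "\<lambda>i p. monom 1 (i * p)" .

text \<open>Indices \<open>(k\<^sub>1,\<dots>,k\<^sub>r)\<close> and summation variables \<open>(l\<^sub>1,\<dots>,l\<^sub>r)\<close> are lists, counted from \<open>0\<close>.\<close>

definition tuples :: "nat \<Rightarrow> nat \<Rightarrow> nat list set" where
  "tuples r p = {l. length l = r \<and> (\<forall>j<r. 0 < l ! j \<and> l ! j < p)}"

definition denom :: "nat list \<Rightarrow> nat list \<Rightarrow> nat" where
  "denom k l = (\<Prod>j<length k. (\<Sum>i\<le>j. l ! i) ^ (k ! j))"

lift_definition OY :: "nat list \<Rightarrow> AZt" is
  "\<lambda>k p. \<Sum>l | l \<in> tuples (length k) p \<and> coprime (denom k l) p.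
           monom (modular_inverse (int p) (int (denom k l))) (sum_list l)" .

lift_definition zeta :: "nat \<Rightarrow> nat list \<Rightarrow> A" is
  "\<lambda>i k p. \<Sum>l | l \<in> tuples (length k) p \<and> (i - 1) * p < sum_list l \<and> sum_list l < i * p
               \<and> coprime (denom k l) p.
             modular_inverse (int p) (int (denom k l))" .

lemma finite_tuples: "finite (tuples r p)"
  by (rule finite_subset[OF _ finite_lists_length_eq[of "{..<p}" r]])
     (auto simp: tuples_def in_set_conv_nth)

lemma OY_Nil: "OY [] = 1"
proof transfer
  show "eqv_AZt (\<lambda>p. \<Sum>l | l \<in> tuples (length []) p \<and> coprime (denom [] l) p.
           monom (modular_inverse (int p) (int (denom [] l))) (sum_list l)) (\<lambda>p. 1)"
    unfolding eqv_AZt_def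
  proof (rule almost_all_primesI, intro allI)
    fix p n :: nat
    assume "prime p"
    then have "int p > 1"
      using prime_gt_1_nat by fastforce
    moreover have "{l. l \<in> tuples (length ([] :: nat list)) p \<and> coprime (denom [] l) p} = {[]}"
      by (auto simp: tuples_def denom_def)
    ultimately show "[coeff (\<Sum>l | l \<in> tuples (length []) p \<and> coprime (denom [] l) p.
           monom (modular_inverse (int p) (int (denom [] l))) (sum_list l)) n = coeff 1 n]
           (mod int p)"
      by (simp add: denom_def)
  qed
qed

text \<open>
  The outer summation range \<open>{..<n - 1}\<close> is \<open>0 \<le> k \<le> n - 2\<close>; it is written like this because
  \<open>{..n - 2}\<close> would not be empty for \<open>n = 1\<close>, by truncated subtraction.
\<close>

definition f_AZt :: "nat \<Rightarrow> AZt" where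
  "f_AZt n = (\<Sum>k<n - 1. (\<Sum>i = 1..n - k - 1.
            A_to_AZt (zeta i (replicate (n - k - 2) 1 @ [2])) * t_pow_p i) * OY (replicate k 1))"

definition g_AZt :: "nat \<Rightarrow> AZt" where
  "g_AZt n = (\<Sum>k<n - 1. (\<Sum>i = 1..n - k - 2.
            A_to_AZt (zeta i (replicate (n - k - 2) 1)) * t_pow_p i) * OY (2 # replicate k 1))"

end

theory Submission
  imports Defs
begin

text \<open>
  Fix a prime \<open>p\<close> and let functions \<open>\<phi>\<close> on residues mod \<open>p\<close> take values in \<open>(\<int>/p\<int>)[t]\<close>. Read
  \<open>inv\<close> as the inverse mod \<open>p\<close>, with \<open>inv 0 = 0\<close>, and consider the operators
  \<open>U\<^sub>k \<phi> a = \<Sum> t\<^sup>x inv (a + x)\<^sup>k \<phi> (a + x)\<close> and \<open>V \<phi> a = \<Sum> t\<^sup>m inv m \<phi> (a + m)\<close>, the sums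
  running over \<open>0 < x < p\<close> and \<open>0 < m < p\<close>. The argument \<open>a\<close> is the partial sum \<open>l\<^sub>1 + \<dots> + l\<^sub>j\<close>
  reached so far, so the \<open>p\<close>-component of the polylogarithm of index \<open>(k\<^sub>1, \<dots>, k\<^sub>r)\<close> is
  \<open>U\<^bsub>k\<^sub>1\<^esub> \<dots> U\<^bsub>k\<^sub>r\<^esub> 1\<close> at \<open>0\<close> (lemma \<open>OY_eq\<close>). Replacing the constant \<open>1\<close> by
  \<open>c a = \<Sum> t\<^sup>m\<close> over the \<open>0 < m < p\<close> with \<open>p dvd a + m\<close> completes the
  exponent \<open>l\<^sub>1 + \<dots> + l\<^sub>r\<close> to the next multiple of \<open>p\<close>; this produces the polynomials
  \<open>\<Sum>\<^sub>i \<zeta>\<^sup>(\<^sup>i\<^sup>) t\<^sup>i\<^sup>p\<close> (lemma \<open>sum_zeta_eq\<close>).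

  For characteristic \<open>0\<close> power series the identity would be \<open>n! Li\<^sub>1\<^sub>\<dots>\<^sub>1 = Li\<^sub>1\<^sup>n\<close>, which comes from
  \<open>inv a inv (a + m) = inv m (inv a - inv (a + m))\<close>. Modulo \<open>p\<close> this partial fraction
  decomposition needs one correction when \<open>a\<close> vanishes and another when \<open>a + m\<close> does
  (lemma \<open>partial_fraction\<close>). In terms of operators it says
  \<open>V U\<^sub>1 \<phi> = U\<^sub>1 V \<phi> - U\<^sub>1\<^sup>2 \<phi> + (U\<^sub>2 c) \<phi>(0) + c (U\<^sub>2 \<phi>)(0)\<close> (lemma \<open>shift_step_commutator\<close>).
  Moving \<open>V\<close> through \<open>U\<^sub>1\<^sup>r\<close> applied to \<open>1\<close> and evaluating at \<open>0\<close>, where \<open>V\<close> and \<open>U\<^sub>1\<close> agree, gives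
  \<open>(r + 1) L\<^sub>r\<^sub>+\<^sub>1 = L\<^sub>1 L\<^sub>r + f\<^sub>r\<^sub>+\<^sub>1 + g\<^sub>r\<^sub>+\<^sub>1\<close>, where \<open>L\<^sub>r\<close> is the polylogarithm of index \<open>{1}\<^sup>r\<close>
  (lemma \<open>OY_recursion\<close>): the first correction yields \<open>g\<close>, the second \<open>f\<close>. The closed formula
  follows by induction on \<open>n\<close>.
\<close>

section \<open>Inverses modulo a prime\<close>

text \<open>
  The value \<open>0\<close> at multiples of \<open>p\<close> is what turns the restricted sums over terms with
  denominator prime to \<open>p\<close> into unrestricted ones.
\<close>

definition minv :: "nat \<Rightarrow> nat \<Rightarrow> int" where
  "minv p a = modular_inverse (int p) (int a)"

lemma minv_cong: 
  assumes "prime p" "[a = b] (mod p)"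
  shows "minv p a = minv p b"
proof (cases "coprime b p")
  case True
  have ab: "[int a = int b] (mod int p)"
    using assms(2) by (simp add: cong_int_iff)
  have "[int a * modular_inverse (int p) (int b) = int b * modular_inverse (int p) (int b)] (mod int p)"
    using ab by (intro cong_mult cong_refl)
  also have "[int b * modular_inverse (int p) (int b) = 1] (mod int p)"
    using True by (intro cong_modular_inverse1) simp
  finally show ?thesis
    unfolding minv_def using prime_gt_0_nat[OF assms(1)]
    by (intro modular_inverse_int_eqI) (auto simp: modular_inverse_int_nonneg modular_inverse_int_less)
next
  case False
  then have "\<not> coprime a p"
    using assms(2) cong_imp_coprime by blast
  then show ?thesis
    using False by (simp add: minv_def)
qed

lemma minv_dvd:
  assumes "prime p" "p dvd a"
  shows "minv p a = 0"
proof -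
  have "\<not> coprime a p"
    using assms by (metis coprime_absorb_right not_prime_unit)
  then show ?thesis
    by (simp add: minv_def)
qed

lemma minv_mult_self:
  assumes "prime p" "\<not> p dvd a"
  shows "[int a * minv p a = 1] (mod int p)"
  unfolding minv_def
  by (intro cong_modular_inverse1) (use assms prime_imp_coprime coprime_commute in auto)

lemma cong_minvI:
  assumes "prime p" "\<not> p dvd a" "[int a * y = 1] (mod int p)"
  shows "[y = minv p a] (mod int p)"
proof -
  have "[int a * y = int a * minv p a] (mod int p)"
    using assms(3) minv_mult_self[OF assms(1,2)] cong_sym cong_trans by blast
  moreover have "coprime (int a) (int p)"
    using assms(1,2) prime_imp_coprime coprime_commute by auto
  ultimately show ?thesis
    by (simp add: cong_mult_lcancel)
qed

lemma minv_mult: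
  assumes "prime p"
  shows "[minv p (a * b) = minv p a * minv p b] (mod int p)"
proof (cases "p dvd a * b")
  case True
  then show ?thesis
    using assms by (auto simp: minv_dvd prime_dvd_mult_iff)
next
  case False
  then have nd: "\<not> p dvd a" "\<not> p dvd b" by auto
  have "[(int a * minv p a) * (int b * minv p b) = 1 * 1] (mod int p)"
    by (intro cong_mult minv_mult_self assms nd)
  then have "[minv p a * minv p b = minv p (a * b)] (mod int p)"
    by (intro cong_minvI assms False) (simp add: mult_ac)
  then show ?thesis by (rule cong_sym)
qed

lemma minv_power:
  assumes "prime p"
  shows "[minv p (a ^ k) = minv p a ^ k] (mod int p)"
proof (induction k)
  case 0
  show ?case using prime_gt_1_nat[OF assms] by (simp add: minv_def)
next
  case (Suc k)
  have "[minv p (a * a ^ k) = minv p a * minv p (a ^ k)] (mod int p)"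
    by (rule minv_mult[OF assms])
  also have "[minv p a * minv p (a ^ k) = minv p a * minv p a ^ k] (mod int p)"
    by (intro cong_mult cong_refl Suc)
  finally show ?case by simp
qed

text \<open>
  For invertible \<open>a\<close> and \<open>a + m\<close> this is \<open>1/a - 1/(a + m) = m / (a (a + m))\<close>, divided by \<open>m\<close> and
  written without subtraction. If \<open>p\<close> divides \<open>a + m\<close>, then \<open>1/m = -1/a\<close> and the term
  \<open>1/(a m)\<close> on the right cancels against \<open>1/a\<^sup>2\<close>; if \<open>p\<close> divides \<open>a\<close>, then \<open>a + m\<close> is \<open>m\<close> mod \<open>p\<close>
  and only \<open>1/m\<^sup>2\<close> survives on both sides.
\<close>

lemma partial_fraction:
  assumes p: "prime p" and m: "\<not> p dvd m"
  shows "[minv p m * minv p (a + m) + minv p a * minv p (a + m)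
          = minv p a * minv p m + (if p dvd a + m then minv p a ^ 2 else 0)
              + (if p dvd a then minv p m ^ 2 else 0)] (mod int p)"
proof -
  consider "p dvd a" | "p dvd a + m" "\<not> p dvd a" | "\<not> p dvd a" "\<not> p dvd a + m"
    by blast
  then show ?thesis
  proof cases
    case 1
    then have "\<not> p dvd a + m"
      using m by (simp add: dvd_add_right_iff)
    moreover have "minv p (a + m) = minv p m"
      using 1 by (intro minv_cong[OF p]) (simp add: cong_def mod_add_left_eq[symmetric])
    ultimately show ?thesis
      using 1 p by (simp add: minv_dvd power2_eq_square)
  next
    case 2
    have "[(int (a + m) - int m) * (- minv p m) = 1] (mod int p)"
    proof -
      have "[int (a + m) * (- minv p m) + int m * minv p m = 0 + 1] (mod int p)"
        using 2 by (intro cong_add minv_mult_self p m) (simp add: cong_0_iff del: of_nat_add)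
      then show ?thesis by (simp add: algebra_simps)
    qed
    then have "[- minv p m = minv p a] (mod int p)"
      by (intro cong_minvI p 2) simp
    then have "[minv p a * (- minv p m) = minv p a * minv p a] (mod int p)"
      by (intro cong_mult cong_refl)
    then have "[minv p a * minv p m + minv p a * (- minv p m)
                = minv p a * minv p m + minv p a * minv p a] (mod int p)"
      by (intro cong_add cong_refl)
    then show ?thesis
      using 2 p by (simp add: minv_dvd power2_eq_square)
  next
    case 3
    let ?A = "int a * minv p a" and ?M = "int m * minv p m" and ?B = "int (a + m) * minv p (a + m)"
    have *: "[?A = 1] (mod int p)" "[?M = 1] (mod int p)" "[?B = 1] (mod int p)"
      using 3 m p by (intro minv_mult_self; simp)+
    have "[minv p m * minv p (a + m) * 1 + minv p a * minv p (a + m) * 1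
           = minv p m * minv p (a + m) * ?A + minv p a * minv p (a + m) * ?M] (mod int p)"
      by (intro cong_add cong_mult cong_refl * [THEN cong_sym])
    also have "minv p m * minv p (a + m) * ?A + minv p a * minv p (a + m) * ?M
               = minv p a * minv p m * ?B"
      by (simp add: algebra_simps)
    also have "[\<dots> = minv p a * minv p m * 1] (mod int p)"
      by (intro cong_mult cong_refl *)
    finally show ?thesis
      using 3 by simp
  qed
qed

section \<open>Congruence of polynomials\<close>

definition pcong :: "nat \<Rightarrow> int poly \<Rightarrow> int poly \<Rightarrow> bool" where
  "pcong p f g \<longleftrightarrow> [:int p:] dvd f - g"

lemma pcong_refl: "pcong p f f"
  by (simp add: pcong_def)

lemma pcong_trans [trans]: "pcong p f g \<Longrightarrow> pcong p g h \<Longrightarrow> pcong p f h"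
  unfolding pcong_def by (drule (1) dvd_add) simp

lemma pcong_add: "pcong p f g \<Longrightarrow> pcong p f' g' \<Longrightarrow> pcong p (f + f') (g + g')"
  unfolding pcong_def by (drule (1) dvd_add) (simp add: algebra_simps)

lemma pcong_mult: "pcong p f g \<Longrightarrow> pcong p f' g' \<Longrightarrow> pcong p (f * f') (g * g')"
  unfolding pcong_def by (subst mult_diff_split) (intro dvd_add dvd_mult dvd_mult2)

lemma pcong_sum: "(\<And>x. x \<in> X \<Longrightarrow> pcong p (f x) (g x)) \<Longrightarrow> pcong p (sum f X) (sum g X)"
  unfolding pcong_def by (simp add: sum_subtractf[symmetric] dvd_sum)

lemma pcong_monom: "[c = d] (mod int p) \<Longrightarrow> pcong p (monom c n) (monom d n)"
  by (auto simp: pcong_def const_poly_dvd_iff cong_iff_dvd_diff)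

text \<open>
  The identities below hold at every prime, so the freedom to ignore finitely many primes is
  used only for dividing by \<open>n!\<close> at the very end.
\<close>

lemma abs_AZt_eqI: "(\<And>p. prime p \<Longrightarrow> pcong p (F p) (G p)) \<Longrightarrow> abs_AZt F = abs_AZt G"
  by (simp add: AZt.abs_eq_iff eqv_AZt_dvd pcong_def almost_all_primesI)

lemma abs_AZt_sum: "(\<Sum>k\<in>K. abs_AZt (F k)) = abs_AZt (\<lambda>p. \<Sum>k\<in>K. F k p)"
  by (induction K rule: infinite_finite_induct)
     (simp_all add: zero_AZt_def plus_AZt.abs_eq)

section \<open>Summation operators\<close>

text \<open>
  These are the operators \<open>U\<^sub>k\<close> and \<open>V\<close> and the function \<open>c\<close> of the introduction. The weight in
  \<open>step\<close> is taken at the new partial sum \<open>a + x\<close>, the one in \<open>shift\<close> at the increment alone, so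
  the two agree at \<open>a = 0\<close> for \<open>k = 1\<close>. Both are defined on natural numbers instead of residues;
  \<open>periodic\<close> records the invariance under the choice of representative.
\<close>

definition step :: "nat \<Rightarrow> nat \<Rightarrow> (nat \<Rightarrow> int poly) \<Rightarrow> nat \<Rightarrow> int poly" where
  "step p k \<phi> a = (\<Sum>x\<in>{0<..<p}. monom (minv p (a + x) ^ k) x * \<phi> (a + x))"

definition shift :: "nat \<Rightarrow> (nat \<Rightarrow> int poly) \<Rightarrow> nat \<Rightarrow> int poly" where
  "shift p \<phi> a = (\<Sum>m\<in>{0<..<p}. monom (minv p m) m * \<phi> (a + m))"

definition closing :: "nat \<Rightarrow> nat \<Rightarrow> int poly" where
  "closing p a = (\<Sum>m\<in>{0<..<p}. monom (if p dvd a + m then 1 else 0) m)"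

definition periodic :: "nat \<Rightarrow> (nat \<Rightarrow> int poly) \<Rightarrow> bool" where
  "periodic p \<phi> \<longleftrightarrow> (\<forall>a b. [a = b] (mod p) \<longrightarrow> \<phi> a = \<phi> b)"

lemma periodic_step:
  assumes "prime p" "periodic p \<phi>"
  shows "periodic p (step p k \<phi>)"
  unfolding periodic_def
proof (intro allI impI)
  fix a b assume "[a = b] (mod p)"
  then have *: "[a + x = b + x] (mod p)" for x
    by (intro cong_add cong_refl)
  have "minv p (a + x) = minv p (b + x)" "\<phi> (a + x) = \<phi> (b + x)" for x
    using minv_cong[OF assms(1) *] assms(2) * unfolding periodic_def by blast+
  then show "step p k \<phi> a = step p k \<phi> b"
    by (simp add: step_def)
qed

lemma step_pcong: "(\<And>a. pcong p (\<phi> a) (\<psi> a)) \<Longrightarrow> pcong p (step p k \<phi> a) (step p k \<psi> a)"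
  unfolding step_def by (intro pcong_sum pcong_mult pcong_refl)

lemma step_add: "step p k (\<lambda>a. \<phi> a + \<psi> a) a = step p k \<phi> a + step p k \<psi> a"
  by (simp add: step_def distrib_left sum.distrib)

lemma step_mult_right: "step p k (\<lambda>a. \<phi> a * c) a = step p k \<phi> a * c"
  by (simp add: step_def sum_distrib_right mult.assoc)

lemma step_mult_left: "step p k (\<lambda>a. c * \<phi> a) a = c * step p k \<phi> a"
  by (simp add: step_def sum_distrib_left mult_ac)

lemma step_sum: "step p k (\<lambda>a. \<Sum>j\<in>J. \<phi> j a) a = (\<Sum>j\<in>J. step p k (\<phi> j) a)"
  by (simp add: step_def sum_distrib_left sum.swap[of _ J])

text \<open>
  All five terms are double sums of \<open>\<phi> (a + x + m) t\<^sup>x\<^sup>+\<^sup>m\<close> with different scalar coefficients, and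
  the coefficients satisfy the identity \<open>partial_fraction\<close> at \<open>a + x\<close>. The two product terms get
  this shape because \<open>\<phi> (a + x + m)\<close> is \<open>\<phi> 0\<close> when \<open>p\<close> divides \<open>a + x + m\<close>, and \<open>\<phi> m\<close> when \<open>p\<close>
  divides \<open>a + x\<close>.
\<close>

lemma shift_step_commutator:
  assumes p: "prime p" and \<phi>: "periodic p \<phi>"
  shows "pcong p (shift p (step p 1 \<phi>) a + step p 1 (step p 1 \<phi>) a)
           (step p 1 (shift p \<phi>) a + step p 2 (closing p) a * \<phi> 0 + closing p a * step p 2 \<phi> 0)"
proof -
  define D where
    "D c = (\<Sum>x\<in>{0<..<p}. \<Sum>m\<in>{0<..<p}. monom (c x m) (x + m) * \<phi> (a + x + m))" for c
  have D_add: "D c + D d = D (\<lambda>x m. c x m + d x m)" for c d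
    by (simp add: D_def sum.distrib distrib_right flip: add_monom)
  have "shift p (step p 1 \<phi>) a =
          (\<Sum>m\<in>{0<..<p}. \<Sum>x\<in>{0<..<p}. monom (minv p m * minv p (a + m + x)) (m + x) * \<phi> (a + m + x))"
    by (simp add: shift_def step_def sum_distrib_left flip: mult_monom mult.assoc)
  also have "\<dots> = D (\<lambda>x m. minv p m * minv p (a + x + m))"
    unfolding D_def by (subst sum.swap) (simp add: add_ac)
  finally have 1: "shift p (step p 1 \<phi>) a = \<dots>" .
  have 2: "step p 1 (step p 1 \<phi>) a = D (\<lambda>x m. minv p (a + x) * minv p (a + x + m))"
    by (simp add: D_def step_def sum_distrib_left flip: mult_monom mult.assoc)
  have 3: "step p 1 (shift p \<phi>) a = D (\<lambda>x m. minv p (a + x) * minv p m)"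
    by (simp add: D_def shift_def step_def sum_distrib_left flip: mult_monom mult.assoc)
  have 4: "step p 2 (closing p) a * \<phi> 0 = D (\<lambda>x m. if p dvd a + x + m then minv p (a + x) ^ 2 else 0)"
    unfolding D_def step_def closing_def sum_distrib_left sum_distrib_right
  proof (intro sum.cong refl)
    fix x m
    show "monom (minv p (a + x) ^ 2) x * monom (if p dvd a + x + m then 1 else 0) m * \<phi> 0
        = monom (if p dvd a + x + m then minv p (a + x) ^ 2 else 0) (x + m) * \<phi> (a + x + m)"
    proof (cases "p dvd a + x + m")
      case True
      then have "\<phi> (a + x + m) = \<phi> 0"
        using \<phi> by (simp add: periodic_def cong_0_iff)
      then show ?thesis using True by (simp add: mult_monom)
    qed (simp add: mult_monom)
  qed
  have 5: "closing p a * step p 2 \<phi> 0 = D (\<lambda>x m. if p dvd a + x then minv p m ^ 2 else 0)"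
    unfolding D_def step_def closing_def sum_distrib_left sum_distrib_right
  proof (subst sum.swap, intro sum.cong refl)
    fix x m
    \<comment> \<open>After the exchange of sums the variable of \<open>closing\<close> is \<open>x\<close>, that of \<open>step\<close> is \<open>m\<close>.\<close>
    show "monom (if p dvd a + x then 1 else 0) x * (monom (minv p (0 + m) ^ 2) m * \<phi> (0 + m))
        = monom (if p dvd a + x then minv p m ^ 2 else 0) (x + m) * \<phi> (a + x + m)"
    proof (cases "p dvd a + x")
      case True
      then have "[a + x + m = 0 + m] (mod p)"
        by (intro cong_add cong_refl) (simp add: cong_0_iff)
      then have "\<phi> (a + x + m) = \<phi> (0 + m)"
        using \<phi> unfolding periodic_def by blast
      then show ?thesis using True by (simp add: mult_monom flip: mult.assoc)
    qed simp
  qed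
  show ?thesis
    unfolding 1 2 3 4 5 D_add unfolding D_def
  proof (intro pcong_sum pcong_mult pcong_refl pcong_monom partial_fraction p)
    fix m assume "m \<in> {0<..<p}"
    then show "\<not> p dvd m" using nat_dvd_not_less by auto
  qed
qed

text \<open>
  Each passage of \<open>V\<close> through one of the \<open>r\<close> factors \<open>U\<^sub>1\<close> costs one \<open>U\<^sub>1\<^sup>r\<^sup>+\<^sup>1\<close> and leaves a product
  in which the factors already passed act on \<open>U\<^sub>2 c\<close> or on \<open>c\<close>, while the remaining ones are
  evaluated at \<open>0\<close> and become scalars. On the constant \<open>1\<close>, \<open>V\<close> acts as multiplication by \<open>L\<^sub>1\<close>.
\<close>

lemma shift_power_step:
  assumes p: "prime p"
  defines "\<phi> \<equiv> \<lambda>r. (step p 1 ^^ r) (\<lambda>_. 1)"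
  shows "pcong p (shift p (\<phi> r) a + of_nat r * \<phi> (Suc r) a)
           (step p 1 (\<lambda>_. 1) 0 * \<phi> r a +
             (\<Sum>j<r. (step p 1 ^^ j) (step p 2 (closing p)) a * \<phi> (r - 1 - j) 0
                   + (step p 1 ^^ j) (closing p) a * step p 2 (\<phi> (r - 1 - j)) 0))"
    (is "pcong p _ (?L * _ + ?S r a)")
proof (induction r arbitrary: a)
  case 0
  show ?case
    by (simp add: shift_def step_def \<phi>_def pcong_refl)
next
  case (Suc r)
  have per: "periodic p (\<phi> r)"
    unfolding \<phi>_def by (induction r) (simp add: periodic_def, simp add: periodic_step[OF p])
  have \<phi>_Suc: "\<phi> (Suc n) = step p 1 (\<phi> n)" for n
    by (simp add: \<phi>_def)
  let ?C = "\<lambda>a. step p 2 (closing p) a * \<phi> r 0 + closing p a * step p 2 (\<phi> r) 0"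
  have S_Suc: "?S (Suc r) a = ?C a + step p 1 (?S r) a"
    by (simp add: step_sum step_add step_mult_right sum.lessThan_Suc_shift flip: Suc_diff_Suc
             del: sum.lessThan_Suc)
  have "pcong p (shift p (\<phi> (Suc r)) a + \<phi> (Suc (Suc r)) a) (step p 1 (shift p (\<phi> r)) a + ?C a)"
    using shift_step_commutator[OF p per, of a] by (simp add: \<phi>_Suc add.assoc)
  then have "pcong p (shift p (\<phi> (Suc r)) a + \<phi> (Suc (Suc r)) a + of_nat r * \<phi> (Suc (Suc r)) a)
          (step p 1 (shift p (\<phi> r)) a + ?C a + of_nat r * \<phi> (Suc (Suc r)) a)"
    by (rule pcong_add[OF _ pcong_refl])
  also have "\<dots> = step p 1 (\<lambda>a. shift p (\<phi> r) a + of_nat r * \<phi> (Suc r) a) a + ?C a"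
    by (simp add: step_add step_mult_left \<phi>_Suc[of "Suc r"])
  also have "pcong p \<dots> (step p 1 (\<lambda>a. ?L * \<phi> r a + ?S r a) a + ?C a)"
    by (intro pcong_add pcong_refl step_pcong Suc.IH)
  also have "\<dots> = ?L * \<phi> (Suc r) a + ?S (Suc r) a"
    unfolding S_Suc by (simp only: step_add step_mult_left \<phi>_Suc add_ac)
  finally show ?case
    by (simp add: algebra_simps)
qed

lemma power_step_recursion:
  assumes p: "prime p"
  defines "\<phi> \<equiv> \<lambda>r. (step p 1 ^^ r) (\<lambda>_. 1)"
  shows "pcong p (of_nat (Suc r) * \<phi> (Suc r) 0)
           (\<phi> 1 0 * \<phi> r 0 +
             (\<Sum>j<r. (step p 1 ^^ j) (step p 2 (closing p)) 0 * \<phi> (r - 1 - j) 0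
                   + (step p 1 ^^ j) (closing p) 0 * step p 2 (\<phi> (r - 1 - j)) 0))"
proof -
  have "shift p (\<phi> r) 0 = \<phi> (Suc r) 0"
    by (simp add: \<phi>_def shift_def step_def)
  then show ?thesis
    using shift_power_step[OF p, of r 0] by (simp add: \<phi>_def algebra_simps)
qed

section \<open>Polylogarithms and zeta values as iterated summations\<close>

text \<open>
  The starting offset \<open>a\<close> of the partial sums allows recursion on the list of summation variables.
\<close>

definition weight :: "nat \<Rightarrow> nat \<Rightarrow> nat list \<Rightarrow> nat list \<Rightarrow> int" where
  "weight p a ks l = (\<Prod>j<length ks. minv p (a + (\<Sum>i\<le>j. l ! i)) ^ (ks ! j))"

lemma weight_Cons: "weight p a (k # ks) (x # l) = minv p (a + x) ^ k * weight p (a + x) ks l"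
  unfolding weight_def
  by (simp add: prod.lessThan_Suc_shift sum.atMost_Suc_shift add.assoc del: prod.lessThan_Suc sum.atMost_Suc)

lemma minv_denom:
  assumes "prime p"
  shows "[minv p (denom ks l) = weight p 0 ks l] (mod int p)"
proof -
  have "[minv p (\<Prod>j<r. b j ^ ks ! j) = (\<Prod>j<r. minv p (b j) ^ ks ! j)] (mod int p)" for r b
  proof (induction r)
    case 0
    show ?case using prime_gt_1_nat[OF assms] by (simp add: minv_def)
  next
    case (Suc r)
    have "[minv p ((\<Prod>j<r. b j ^ ks ! j) * b r ^ ks ! r)
            = minv p (\<Prod>j<r. b j ^ ks ! j) * minv p (b r ^ ks ! r)] (mod int p)"
      by (rule minv_mult[OF assms])
    also have "[minv p (\<Prod>j<r. b j ^ ks ! j) * minv p (b r ^ ks ! r)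
                 = (\<Prod>j<r. minv p (b j) ^ ks ! j) * minv p (b r) ^ ks ! r] (mod int p)"
      by (intro cong_mult Suc minv_power assms)
    finally show ?case by simp
  qed
  then show ?thesis by (simp add: denom_def weight_def)
qed

lemma tuples_0: "tuples 0 p = {[]}"
  by (auto simp: tuples_def)

lemma tuples_Suc: "tuples (Suc r) p = (\<lambda>(x, l). x # l) ` ({0<..<p} \<times> tuples r p)"
proof -
  have "l \<in> tuples (Suc r) p \<longleftrightarrow> (\<exists>x l'. l = x # l' \<and> x \<in> {0<..<p} \<and> l' \<in> tuples r p)" for l
    by (cases l) (auto simp: tuples_def less_Suc_eq_0_disj)
  then show ?thesis by (auto simp: set_eq_iff image_iff)
qed

lemma sum_tuples_Suc: "(\<Sum>l\<in>tuples (Suc r) p. f l) = (\<Sum>x\<in>{0<..<p}. \<Sum>l\<in>tuples r p. f (x # l))"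
  unfolding tuples_Suc
  by (subst sum.reindex) (auto simp: inj_on_def sum.cartesian_product case_prod_unfold)

lemma sum_list_tuples: "l \<in> tuples r p \<Longrightarrow> sum_list l + r \<le> r * p"
  by (induction r arbitrary: l) (fastforce simp: tuples_0 tuples_Suc)+

text \<open>
  The offset \<open>a\<close> and the terminal function \<open>\<psi>\<close> are arbitrary so that the same expansion serves
  the induction, the polylogarithms (\<open>\<psi> = 1\<close>) and the zeta values (\<open>\<psi> = closing p\<close>).
\<close>

lemma foldr_step:
  "foldr (step p) ks \<psi> a =
     (\<Sum>l\<in>tuples (length ks) p. monom (weight p a ks l) (sum_list l) * \<psi> (a + sum_list l))"
proof (induction ks arbitrary: a)
  case Nil
  show ?case by (simp add: tuples_0 weight_def)
next
  case (Cons k ks)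
  show ?case
    by (simp add: step_def[of p k] Cons sum_tuples_Suc weight_Cons sum_distrib_left mult_monom
        add.assoc flip: mult.assoc)
qed

lemma OY_eq: "OY ks = abs_AZt (\<lambda>p. foldr (step p) ks (\<lambda>_. 1) 0)"
  unfolding OY_def map_fun_apply id_apply
proof (rule abs_AZt_eqI)
  fix p :: nat assume p: "prime p"
  have "(\<Sum>l | l \<in> tuples (length ks) p \<and> coprime (denom ks l) p.
           monom (modular_inverse (int p) (int (denom ks l))) (sum_list l))
        = (\<Sum>l\<in>tuples (length ks) p. monom (minv p (denom ks l)) (sum_list l))"
    unfolding minv_def by (intro sum.mono_neutral_left finite_tuples) auto
  also have "pcong p \<dots> (\<Sum>l\<in>tuples (length ks) p. monom (weight p 0 ks l) (sum_list l))"
    by (intro pcong_sum pcong_monom minv_denom p)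
  also have "\<dots> = foldr (step p) ks (\<lambda>_. 1) 0"
    by (simp add: foldr_step)
  finally show "pcong p (\<Sum>l | l \<in> tuples (length ks) p \<and> coprime (denom ks l) p.
           monom (modular_inverse (int p) (int (denom ks l))) (sum_list l))
         (foldr (step p) ks (\<lambda>_. 1) 0)" .
qed

text \<open>
  If \<open>p\<close> does not divide \<open>s\<close>, exactly one \<open>0 < m < p\<close> brings \<open>s\<close> to a multiple \<open>i p\<close> of \<open>p\<close>, namely
  to the end of the interval \<open>](i - 1) p, i p[\<close> that contains \<open>s\<close>, and \<open>s < r p\<close> forces \<open>i \<le> r\<close>. If
  \<open>p\<close> divides \<open>s\<close>, there is neither such an \<open>m\<close> nor such an interval.
\<close>

lemma monom_closing:
  assumes "p > 0" "s + r \<le> r * p"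
  shows "monom 1 s * closing p s =
           (\<Sum>i = 1..r. monom (if (i - 1) * p < s \<and> s < i * p then 1 else 0) (i * p))"
proof (cases "p dvd s")
  case True
  then obtain q where q: "s = q * p" by (metis dvd_div_mult_self)
  have "\<not> p dvd s + m" if "m \<in> {0<..<p}" for m
    using True that by (auto simp: dvd_add_right_iff dest: dvd_imp_le)
  moreover have "\<not> ((i - 1) * p < s \<and> s < i * p)" for i
    using q by auto
  ultimately show ?thesis by (simp add: closing_def cong: conj_cong)
next
  case False
  define i0 where "i0 = Suc (s div p)"
  have s: "s = s div p * p + s mod p" by simp
  have mod: "0 < s mod p" "s mod p < p"
    using False assms(1) by (auto simp: dvd_eq_mod_eq_0)
  have bounds: "(i0 - 1) * p < s" "s < i0 * p"
    using mod s unfolding i0_def by (simp_all, linarith+)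
  have "r > 0"
    using assms(2) False by (cases r) auto
  then have "s < r * p"
    using assms(2) by linarith
  then have "(i0 - 1) * p < r * p"
    using bounds by linarith
  then have i0: "i0 \<in> {1..r}"
    by (auto simp: i0_def)
  have i_iff: "(i - 1) * p < s \<and> s < i * p \<longleftrightarrow> i = i0" for i
  proof
    assume i: "(i - 1) * p < s \<and> s < i * p"
    then have "(i - 1) * p < i0 * p" "(i0 - 1) * p < i * p"
      using bounds by linarith+
    then have "i - 1 < i0" "i0 - 1 < i"
      by (simp_all only: mult_less_cancel2)
    then show "i = i0" by (simp add: i0_def)
  qed (use bounds in auto)
  define m0 where "m0 = i0 * p - s"
  have m0: "m0 \<in> {0<..<p}" "s + m0 = i0 * p"
    using bounds s mod by (simp_all add: m0_def i0_def, linarith+)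
  have m_iff: "p dvd s + m \<longleftrightarrow> m = m0" if "m \<in> {0<..<p}" for m
  proof
    assume "p dvd s + m"
    then have "[s + m = s + m0] (mod p)"
      by (simp add: m0 cong_def dvd_eq_mod_eq_0)
    then have "[m = m0] (mod p)" by (simp only: cong_add_lcancel_nat)
    then show "m = m0" using that m0 by (simp add: cong_less_modulus_unique_nat)
  qed (simp add: m0)
  have "closing p s = (\<Sum>m\<in>{0<..<p}. if m = m0 then monom 1 m else 0)"
    unfolding closing_def by (intro sum.cong refl) (simp add: m_iff)
  also have "\<dots> = monom 1 m0"
    using m0 by (simp add: sum.delta)
  finally have "monom 1 s * closing p s = monom 1 (i0 * p)"
    by (simp add: mult_monom m0)
  also have "\<dots> = (\<Sum>i = 1..r. if i = i0 then monom 1 (i * p) else 0)"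
    using i0 by (simp add: sum.delta)
  also have "\<dots> = (\<Sum>i = 1..r. monom (if (i - 1) * p < s \<and> s < i * p then 1 else 0) (i * p))"
    unfolding i_iff by (intro sum.cong refl) simp
  finally show ?thesis .
qed

text \<open>
  Summed over \<open>i\<close>, the intervals in the definition of \<open>zeta i\<close> sort the tuples by the multiple of \<open>p\<close>
  that follows their total, and the exponent \<open>i p\<close> is what \<open>closing\<close> produces from that total.
\<close>

lemma sum_zeta_eq:
  "(\<Sum>i = 1..length ks. A_to_AZt (zeta i ks) * t_pow_p i) =
     abs_AZt (\<lambda>p. foldr (step p) ks (closing p) 0)"
proof -
  let ?r = "length ks"
  define I where "I p l i \<longleftrightarrow> (i - 1) * p < sum_list l \<and> sum_list l < i * p"
    for p i :: nat and l :: "nat list"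
  define Z where "Z p i = (\<Sum>l | l \<in> tuples ?r p \<and> (i - 1) * p < sum_list l \<and> sum_list l < i * p
               \<and> coprime (denom ks l) p. modular_inverse (int p) (int (denom ks l)))"
    for p i :: nat
  have "(\<Sum>i = 1..?r. A_to_AZt (zeta i ks) * t_pow_p i)
        = abs_AZt (\<lambda>p. \<Sum>i = 1..?r. [:Z p i:] * monom 1 (i * p))"
    by (simp add: zeta_def t_pow_p_def A_to_AZt.abs_eq times_AZt.abs_eq abs_AZt_sum Z_def)
  also have "\<dots> = abs_AZt (\<lambda>p. foldr (step p) ks (closing p) 0)"
  proof (rule abs_AZt_eqI)
    fix p :: nat assume p: "prime p"
    have Z: "Z p i = (\<Sum>l\<in>tuples ?r p. if I p l i then minv p (denom ks l) else 0)" for i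
      unfolding Z_def I_def minv_def
      by (intro sum.mono_neutral_cong_left finite_tuples) auto
    have "(\<Sum>i = 1..?r. [:Z p i:] * monom 1 (i * p))
          = (\<Sum>l\<in>tuples ?r p. \<Sum>i = 1..?r. monom (if I p l i then minv p (denom ks l) else 0) (i * p))"
      by (subst sum.swap) (simp add: Z smult_monom smult_sum flip: monom_sum)
    also have "\<dots> = (\<Sum>l\<in>tuples ?r p. monom (minv p (denom ks l)) (sum_list l) * closing p (sum_list l))"
    proof (intro sum.cong refl)
      fix l assume l: "l \<in> tuples ?r p"
      let ?c = "minv p (denom ks l)"
      have "monom ?c (sum_list l) * closing p (sum_list l)
            = smult ?c (monom 1 (sum_list l) * closing p (sum_list l))"
        by (simp add: smult_monom flip: mult_smult_left)
      also have "\<dots> = smult ?c (\<Sum>i = 1..?r. monom (if I p l i then 1 else 0) (i * p))"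
        using monom_closing[OF prime_gt_0_nat[OF p] sum_list_tuples[OF l]] by (simp add: I_def)
      also have "\<dots> = (\<Sum>i = 1..?r. monom (if I p l i then ?c else 0) (i * p))"
        by (intro poly_eqI) (auto simp: coeff_sum sum_distrib_left intro!: sum.cong)
      finally show "(\<Sum>i = 1..?r. monom (if I p l i then ?c else 0) (i * p))
            = monom ?c (sum_list l) * closing p (sum_list l)" ..
    qed
    also have "pcong p \<dots> (\<Sum>l\<in>tuples ?r p. monom (weight p 0 ks l) (sum_list l) * closing p (sum_list l))"
      by (intro pcong_sum pcong_mult pcong_refl pcong_monom minv_denom p)
    also have "\<dots> = foldr (step p) ks (closing p) 0"
      by (simp add: foldr_step)
    finally show "pcong p (\<Sum>i = 1..?r. [:Z p i:] * monom 1 (i * p)) (foldr (step p) ks (closing p) 0)" .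
  qed
  finally show ?thesis .
qed

section \<open>The recursion and its solution\<close>

text \<open>
  The new summation index \<open>j = r - 1 - k\<close> is the number of entries \<open>1\<close> in the zeta value, which is
  the number of factors \<open>U\<^sub>1\<close> passed in \<open>shift_power_step\<close>.
\<close>

lemma f_AZt_eq:
  "f_AZt (Suc r) = abs_AZt (\<lambda>p. \<Sum>j<r. (step p 1 ^^ j) (step p 2 (closing p)) 0
                                     * (step p 1 ^^ (r - 1 - j)) (\<lambda>_. 1) 0)"
proof -
  have "f_AZt (Suc r) = (\<Sum>k<r. (\<Sum>i = 1..length (replicate (r - Suc k) (1::nat) @ [2]).
      A_to_AZt (zeta i (replicate (r - Suc k) 1 @ [2])) * t_pow_p i) * OY (replicate k 1))"
    unfolding f_AZt_def by (intro sum.cong refl arg_cong2[where f = "(*)"]) auto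
  also have "\<dots> = abs_AZt (\<lambda>p. \<Sum>k<r. (step p 1 ^^ (r - Suc k)) (step p 2 (closing p)) 0
                                     * (step p 1 ^^ k) (\<lambda>_. 1) 0)"
    unfolding sum_zeta_eq OY_eq times_AZt.abs_eq abs_AZt_sum by simp
  also have "\<dots> = abs_AZt (\<lambda>p. \<Sum>j<r. (step p 1 ^^ j) (step p 2 (closing p)) 0
                                     * (step p 1 ^^ (r - 1 - j)) (\<lambda>_. 1) 0)"
    by (subst sum.nat_diff_reindex[symmetric]) (auto intro!: arg_cong[where f = abs_AZt] ext sum.cong)
  finally show ?thesis .
qed

lemma g_AZt_eq:
  "g_AZt (Suc r) = abs_AZt (\<lambda>p. \<Sum>j<r. (step p 1 ^^ j) (closing p) 0
                                     * step p 2 ((step p 1 ^^ (r - 1 - j)) (\<lambda>_. 1)) 0)"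
proof -
  have "g_AZt (Suc r) = (\<Sum>k<r. (\<Sum>i = 1..length (replicate (r - Suc k) (1::nat)).
      A_to_AZt (zeta i (replicate (r - Suc k) 1)) * t_pow_p i) * OY (2 # replicate k 1))"
    unfolding g_AZt_def by (intro sum.cong refl arg_cong2[where f = "(*)"]) auto
  also have "\<dots> = abs_AZt (\<lambda>p. \<Sum>k<r. (step p 1 ^^ (r - Suc k)) (closing p) 0
                                     * step p 2 ((step p 1 ^^ k) (\<lambda>_. 1)) 0)"
    unfolding sum_zeta_eq OY_eq times_AZt.abs_eq abs_AZt_sum by simp
  also have "\<dots> = abs_AZt (\<lambda>p. \<Sum>j<r. (step p 1 ^^ j) (closing p) 0
                                     * step p 2 ((step p 1 ^^ (r - 1 - j)) (\<lambda>_. 1)) 0)"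
    by (subst sum.nat_diff_reindex[symmetric]) (auto intro!: arg_cong[where f = abs_AZt] ext sum.cong)
  finally show ?thesis .
qed

lemma of_nat_AZt: "of_nat k = abs_AZt (\<lambda>p. of_nat k)"
  by (induction k) (simp_all add: zero_AZt_def one_AZt_def plus_AZt.abs_eq)

lemma OY_recursion:
  "of_nat (Suc r) * OY (replicate (Suc r) 1)
     = OY [1] * OY (replicate r 1) + (f_AZt (Suc r) + g_AZt (Suc r))"
proof -
  have "OY (replicate (Suc r) 1) = abs_AZt (\<lambda>p. (step p 1 ^^ Suc r) (\<lambda>_. 1) 0)"
       "OY (replicate r 1) = abs_AZt (\<lambda>p. (step p 1 ^^ r) (\<lambda>_. 1) 0)"
       "OY [1] = abs_AZt (\<lambda>p. (step p 1 ^^ 1) (\<lambda>_. 1) 0)"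
    unfolding OY_eq by simp_all
  then show ?thesis
    unfolding f_AZt_eq g_AZt_eq of_nat_AZt plus_AZt.abs_eq times_AZt.abs_eq
    by (simp only: sum.distrib[symmetric] plus_AZt.abs_eq times_AZt.abs_eq)
       (intro abs_AZt_eqI power_step_recursion)
qed

lemma fact_times_OY:
  "of_nat (fact n) * OY (replicate n 1)
     = OY [1] ^ n + (\<Sum>k = 1..n. of_nat (fact (k - 1)) * (f_AZt k + g_AZt k) * OY [1] ^ (n - k))"
proof (induction n)
  case 0
  show ?case by (simp add: OY_Nil)
next
  case (Suc n)
  let ?L = "OY [1]" and ?h = "\<lambda>k. f_AZt k + g_AZt k"
  have "of_nat (fact (Suc n)) * OY (replicate (Suc n) 1)
        = of_nat (fact n) * (of_nat (Suc n) * OY (replicate (Suc n) 1))"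
    by (simp only: fact_Suc of_nat_mult of_nat_id mult_ac)
  also have "\<dots> = ?L * (of_nat (fact n) * OY (replicate n 1)) + of_nat (fact n) * ?h (Suc n)"
    unfolding OY_recursion by (simp only: distrib_left mult_ac)
  also have "?L * (of_nat (fact n) * OY (replicate n 1))
        = ?L ^ Suc n + (\<Sum>k = 1..n. of_nat (fact (k - 1)) * ?h k * ?L ^ (Suc n - k))"
    unfolding Suc by (simp add: distrib_left sum_distrib_left Suc_diff_le mult_ac)
  finally show ?case by (simp add: add.assoc)
qed

lemma scaleQ_of_nat: "scaleQ (of_nat k) x = of_nat k * x"
proof -
  interpret module scaleQ by (rule module_scaleQ)
  show ?thesis by (induction k) (simp_all add: scale_left_distrib distrib_right)
qed

theorem theorem1p3:
  fixes n :: nat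
  assumes "n \<ge> 1"
  shows "OY (replicate n 1) =
           scaleQ (1 / fact n) (OY [1] ^ n) +
           scaleQ (1 / fact n)
             (\<Sum>k = 1..n. of_nat (fact (k - 1)) * (f_AZt k + g_AZt k) * OY [1] ^ (n - k))"
proof -
  interpret module scaleQ by (rule module_scaleQ)
  have "OY (replicate n 1) = scaleQ (1 / fact n) (scaleQ (of_nat (fact n)) (OY (replicate n 1)))"
    by simp
  then show ?thesis
    unfolding scaleQ_of_nat fact_times_OY by (simp only: scale_right_distrib)
qed

end
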